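(* Let $(\mathbf{v},\mathbf{B})\in\mathcal{D}_n$ with $\mathbf{v}=(v_1,\ldots,v_n)$ and $\mathbf{B}=(b_1,\ldots,b_n)$. Suppose $\mathbf{X},\mathbf{Y}\in\mathbb{D}_n$ are such that $$c_i(\mathbf{X};\mathbf{v})=c_i(\mathbf{Y};\mathbf{v})=b_i\quad\forall\, i\in\{1,\ldots,n\}.$$ Then $$L_i(\mathbf{X};\mathbf{v})=L_i(\mathbf{Y};\mathbf{v})\quad\forall\, i\in\{1,\ldots,n\}.$$ In other words, a Laguerre tessellation is uniquely determined by the volumes and centroids of its cells.
   Context: Let $d\ge 2$ and let $\Omega\subset\mathbb{R}^d$ be a non-empty, convex, bounded set equal to the closure of its interior. For a Lebesgue-measurable $A\subseteq\mathbb{R}^d$, $\mathrm{vol}(A)$ is its $d$-dimensional Lebesgue measure and, if $\mathrm{vol}(A)\neq 0$, $\sigma(A)=\frac{1}{\mathrm{vol}(A)}\int_A x\,dx$ is its centroid. $\mathbb{D}_n=\{\mathbf{X}=(x_1,\ldots,x_n)\in(\mathbb{R}^d)^n : x_i\ne x_j \text{ for all } i\neq j\}$ is the set of distinct seeds. For $\mathbf{X}\in\mathbb{D}_n$ and $\mathbf{w}=(w_1,\ldots,w_n)\in\mathbb{R}^n$, the $i$-th Laguerre cell is $$\mathrm{Lag}_i(\mathbf{X},\mathbf{w})=\{x\in\Omega : |x-x_i|^2-w_i\le |x-x_j|^2-w_j\ \forall j\in\{1,\ldots,n\}\}.$$ $\mathbb{V}_n=\{\mathbf{v}\in(0,\infty)^n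 : \sum_{i=1}^n v_i=\mathrm{vol}(\Omega)\}$. For $\mathbf{X}\in\mathbb{D}_n$ and $\mathbf{v}\in\mathbb{V}_n$, it is known that there exists $\mathbf{w}\in\mathbb{R}^n$, unique up to adding the same constant to all components (and made unique by requiring $w_n=0$), such that $\mathrm{vol}(\mathrm{Lag}_i(\mathbf{X},\mathbf{w}))=v_i$ for all $i$; denote it $\mathbf{w}^*(\mathbf{X};\mathbf{v})$. Set $L_i(\mathbf{X};\mathbf{v})=\mathrm{Lag}_i(\mathbf{X},\mathbf{w}^*(\mathbf{X};\mathbf{v}))$ and $c_i(\mathbf{X};\mathbf{v})=\sigma(L_i(\mathbf{X};\mathbf{v}))$. The set of compatible data is $$\mathcal{D}_n=\Big\{(\mathbf{v},\mathbf{B})\in\mathbb{V}_n\times\Omega^n : \sum_{i=1}^n v_ib_i=\mathrm{vol}(\Omega)\,\sigma(\Omega)\Big\}.$$ *)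

theory Defs
  imports "HOL-Analysis.Analysis"
begin

text \<open>
  The ambient space is \<^typ>\<open>real ^ 'd\<close>. The index set \<open>{1, \<dots>, n}\<close> is a finite linearly ordered
  type \<open>'n\<close>; its largest element \<^term>\<open>Max UNIV\<close> plays the role of the index \<open>n\<close>, and is used only
  for the normalisation \<open>w\<^sub>n = 0\<close> of the weights. The domain \<open>\<Omega>\<close> is an explicit argument throughout.
\<close>

abbreviation vol :: "(real ^ 'd) set \<Rightarrow> real" where
  "vol A \<equiv> measure lebesgue A"

text \<open>Only meaningful for \<open>vol A \<noteq> 0\<close>; the junk value for \<open>vol A = 0\<close> is \<open>0\<close>.\<close>

definition centroid :: "(real ^ 'd) set \<Rightarrow> real ^ 'd" where
  "centroid A = (1 / vol A) *\<^sub>R (LINT x:A|lebesgue. x)"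

definition distinct_seeds :: "((real ^ 'd) ^ 'n) set" where
  "distinct_seeds = {X. \<forall>i j. i \<noteq> j \<longrightarrow> X $ i \<noteq> X $ j}"

definition Lag :: "(real ^ 'd) set \<Rightarrow> (real ^ 'd) ^ 'n \<Rightarrow> real ^ 'n \<Rightarrow> 'n \<Rightarrow> (real ^ 'd) set" where
  "Lag \<Omega> X w i =
     {x \<in> \<Omega>. \<forall>j. (norm (x - X $ i))\<^sup>2 - w $ i \<le> (norm (x - X $ j))\<^sup>2 - w $ j}"

definition volume_vectors :: "(real ^ 'd) set \<Rightarrow> (real ^ 'n) set" where
  "volume_vectors \<Omega> = {v. (\<forall>i. 0 < v $ i) \<and> (\<Sum>i\<in>UNIV. v $ i) = vol \<Omega>}"

text \<open>
  The description below is proper (existence and uniqueness) for a convex, bounded \<open>\<Omega>\<close> with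
  \<open>\<Omega> = closure (interior \<Omega>) \<noteq> {}\<close>, distinct seeds \<open>X\<close> and \<open>v \<in> volume_vectors \<Omega>\<close>; this is a
  theorem and is not built into the definition.
\<close>

definition opt_weights ::
  "(real ^ 'd) set \<Rightarrow> (real ^ 'd) ^ 'n::{finite,linorder} \<Rightarrow> real ^ 'n::{finite,linorder} \<Rightarrow>
    real ^ 'n::{finite,linorder}" where
  "opt_weights \<Omega> X v = (THE w. w $ Max UNIV = 0 \<and> (\<forall>i. vol (Lag \<Omega> X w i) = v $ i))"

definition opt_cell ::
  "(real ^ 'd) set \<Rightarrow> (real ^ 'd) ^ 'n::{finite,linorder} \<Rightarrow> real ^ 'n::{finite,linorder} \<Rightarrow>
    'n::{finite,linorder} \<Rightarrow> (real ^ 'd) set" where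
  "opt_cell \<Omega> X v i = Lag \<Omega> X (opt_weights \<Omega> X v) i"

definition opt_centroid ::
  "(real ^ 'd) set \<Rightarrow> (real ^ 'd) ^ 'n::{finite,linorder} \<Rightarrow> real ^ 'n::{finite,linorder} \<Rightarrow>
    'n::{finite,linorder} \<Rightarrow> real ^ 'd" where
  "opt_centroid \<Omega> X v i = centroid (opt_cell \<Omega> X v i)"

definition compatible_data :: "(real ^ 'd) set \<Rightarrow> ((real ^ 'n) \<times> ((real ^ 'd) ^ 'n)) set" where
  "compatible_data \<Omega> =
     {(v, B). v \<in> volume_vectors \<Omega> \<and> (\<forall>i. B $ i \<in> \<Omega>) \<and>
        (\<Sum>i\<in>UNIV. v $ i *\<^sub>R B $ i) = vol \<Omega> *\<^sub>R centroid \<Omega>}"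

end

theory Submission
  imports Defs
begin

text \<open>
  Up to the common term \<open>|x|\<^sup>2\<close>, the \<open>i\<close>-th Laguerre cell is the set where the affine function
  \<open>h\<^sub>i x = 2 x \<bullet> x\<^sub>i - |x\<^sub>i|\<^sup>2 + w\<^sub>i\<close> attains the upper envelope \<open>\<phi> = max\<^sub>j h\<^sub>j\<close>. Hence the cells \<open>P\<^sub>i\<close> of
  \<open>X\<close> maximise \<open>\<Sum>\<^sub>i \<integral>\<^bsub>Q\<^sub>i\<^esub> h\<^sub>i\<close> among all partitions \<open>Q\<close> of \<open>\<Omega>\<close>, and a partition into convex bodies that
  does at least as well must satisfy \<open>Q\<^sub>i \<subseteq> P\<^sub>i\<close>. Since the \<open>h\<^sub>i\<close> are affine, the sum depends on \<open>Q\<close>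
  only through the volumes and centroids of the \<open>Q\<^sub>i\<close>, so two tessellations with the same data are
  contained in each other. The same inequality gives the uniqueness of the optimal weights, and
  their existence follows by minimising the convex function \<open>w \<mapsto> \<integral>\<^bsub>\<Omega>\<^esub> \<phi> - \<Sum>\<^sub>i v\<^sub>i w\<^sub>i\<close>.
\<close>

section \<open>Continuity and integrability preliminaries\<close>

lemma continuous_on_Max_image:
  fixes f :: "'i \<Rightarrow> 'a::topological_space \<Rightarrow> real"
  assumes "finite I" "I \<noteq> {}" "\<And>i. i \<in> I \<Longrightarrow> continuous_on S (f i)"
  shows "continuous_on S (\<lambda>x. Max ((\<lambda>i. f i x) ` I))"
  using assms
proof (induction I rule: finite_ne_induct)
  case (insert i I)
  then have "continuous_on S (\<lambda>x. max (f i x) (Max ((\<lambda>i. f i x) ` I)))"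
    by (intro continuous_on_max) auto
  with insert show ?case by simp
qed auto

lemma absolutely_integrable_continuous_compact:
  fixes f :: "'a::euclidean_space \<Rightarrow> 'b::euclidean_space"
  assumes "compact S" "continuous_on S f"
  shows "f absolutely_integrable_on S"
proof -
  have "integrable lborel (\<lambda>x. indicat_real S x *\<^sub>R f x)"
    using assms by (rule borel_integrable_compact)
  then show ?thesis
    by (simp add: set_integrable_def integrable_completion)
qed

lemma set_integral_inner_right:
  fixes f :: "'a \<Rightarrow> 'b::{real_inner, banach, second_countable_topology}"
  assumes "set_integrable M A f"
  shows "(LINT x:A|M. f x \<bullet> c) = (LINT x:A|M. f x) \<bullet> c"
  using assms unfolding set_integrable_def set_lebesgue_integral_def
  by (simp flip: integral_inner_left)

section \<open>Heights, their upper envelope and the geometry of cells\<close>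

definition height :: "('a::real_inner) ^ 'n \<Rightarrow> real ^ 'n \<Rightarrow> 'n \<Rightarrow> 'a \<Rightarrow> real" where
  "height X w i x = 2 * (x \<bullet> X $ i) - (norm (X $ i))\<^sup>2 + w $ i"

definition envelope :: "('a::real_inner) ^ 'n \<Rightarrow> real ^ 'n \<Rightarrow> 'a \<Rightarrow> real" where
  "envelope X w x = (MAX i. height X w i x)"

lemma height_le_envelope: "height X w i x \<le> envelope X w x"
  unfolding envelope_def by (intro Max_ge) auto

lemma envelope_attained: obtains i where "envelope X w x = height X w i x"
proof -
  have "envelope X w x \<in> range (\<lambda>i. height X w i x)"
    unfolding envelope_def by (intro Max_in) auto
  with that show thesis by auto
qed

lemma continuous_on_height: "continuous_on S (height X w i)"
  unfolding height_def by (intro continuous_intros)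

lemma continuous_on_envelope: "continuous_on S (envelope X w)"
proof -
  have "continuous_on S (\<lambda>x. MAX i. height X w i x)"
    by (intro continuous_on_Max_image continuous_on_height) auto
  then show ?thesis by (simp add: envelope_def[abs_def])
qed

lemma mem_Lag_iff: "x \<in> Lag \<Omega> X w i \<longleftrightarrow> x \<in> \<Omega> \<and> (\<forall>j. height X w j x \<le> height X w i x)"
proof -
  have "(norm (x - X $ j))\<^sup>2 - w $ j = (norm x)\<^sup>2 - height X w j x" for j
    unfolding height_def power2_norm_eq_inner by (simp add: algebra_simps inner_commute)
  then show ?thesis by (simp add: Lag_def)
qed

lemma mem_Lag_iff_envelope: "x \<in> Lag \<Omega> X w i \<longleftrightarrow> x \<in> \<Omega> \<and> envelope X w x = height X w i x"
proof -
  have "(\<forall>j. height X w j x \<le> height X w i x) \<longleftrightarrow> envelope X w x = height X w i x"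
    by (metis envelope_attained height_le_envelope order_antisym)
  then show ?thesis by (simp add: mem_Lag_iff)
qed

lemma Lag_subset: "Lag \<Omega> X w i \<subseteq> \<Omega>"
  by (auto simp: Lag_def)

lemma UN_Lag: "(\<Union>i. Lag \<Omega> X w i) = \<Omega>"
  by (auto simp: mem_Lag_iff_envelope) (metis envelope_attained)

lemma Lag_shift: "Lag \<Omega> X (\<chi> i. w $ i + c) i = Lag \<Omega> X w i"
  by (auto simp: Lag_def)

lemma compact_Lag:
  assumes "compact \<Omega>" shows "compact (Lag \<Omega> X w i)"
proof -
  have "Lag \<Omega> X w i = \<Omega> \<inter> {x. envelope X w x = height X w i x}"
    by (auto simp: mem_Lag_iff_envelope)
  with assms show ?thesis
    by (simp add: compact_Int_closed closed_Collect_eq continuous_on_envelope continuous_on_height)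
qed

lemma convex_Lag:
  assumes "convex \<Omega>" shows "convex (Lag \<Omega> X w i)"
proof -
  have "Lag \<Omega> X w i = \<Omega> \<inter> (\<Inter>j. {x. (2 *\<^sub>R (X $ j - X $ i)) \<bullet> x
      \<le> w $ i - w $ j + (norm (X $ j))\<^sup>2 - (norm (X $ i))\<^sup>2})"
    by (auto simp: mem_Lag_iff height_def algebra_simps inner_commute)
  with assms show ?thesis
    by (simp only:) (intro convex_Int convex_INT convex_halfspace_le)
qed

text \<open>On the overlap the two heights agree. This is an affine equation with normal
  \<open>2 *\<^sub>R (X $ j - X $ i)\<close>, nonzero because the seeds are distinct, so the overlap
  lies in a hyperplane.\<close>

lemma negligible_Lag_Int:
  assumes "X \<in> distinct_seeds" "i \<noteq> j"
  shows "negligible (Lag \<Omega> X w i \<inter> Lag \<Omega> X w j)"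
proof (rule negligible_subset)
  show "negligible {x. (2 *\<^sub>R (X $ j - X $ i)) \<bullet> x
      = w $ i - w $ j + (norm (X $ j))\<^sup>2 - (norm (X $ i))\<^sup>2}"
    using assms by (intro negligible_hyperplane) (auto simp: distinct_seeds_def)
  show "Lag \<Omega> X w i \<inter> Lag \<Omega> X w j \<subseteq> {x. (2 *\<^sub>R (X $ j - X $ i)) \<bullet> x
      = w $ i - w $ j + (norm (X $ j))\<^sup>2 - (norm (X $ i))\<^sup>2}"
    by (auto simp: mem_Lag_iff_envelope height_def algebra_simps inner_commute)
qed

lemma lmeasurable_Lag: "compact \<Omega> \<Longrightarrow> Lag \<Omega> X w i \<in> lmeasurable"
  by (intro lmeasurable_compact compact_Lag)

section \<open>Integrals over cells\<close>

lemma set_integral_Lag_sum: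
  fixes X :: "(real ^ 'd) ^ 'n" and f :: "real ^ 'd \<Rightarrow> real"
  assumes "compact \<Omega>" "X \<in> distinct_seeds" "continuous_on \<Omega> f"
  shows "(LINT x:\<Omega>|lebesgue. f x) = (\<Sum>i\<in>UNIV. LINT x:Lag \<Omega> X w i|lebesgue. f x)"
proof -
  have "(LINT x:(\<Union>i. Lag \<Omega> X w i)|lebesgue. f x) = (\<Sum>i\<in>UNIV. LINT x:Lag \<Omega> X w i|lebesgue. f x)"
  proof (rule set_integral_finite_UN_AE)
    fix i j
    show "AE x in lebesgue. x \<in> Lag \<Omega> X w i \<and> x \<in> Lag \<Omega> X w j \<longrightarrow> i = j"
    proof (cases "i = j")
      case False
      then have "Lag \<Omega> X w i \<inter> Lag \<Omega> X w j \<in> null_sets lebesgue"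
        using negligible_Lag_Int[OF assms(2)] by (simp add: negligible_iff_null_sets)
      from AE_not_in[OF this] show ?thesis by eventually_elim (simp add: False)
    qed simp
    show "Lag \<Omega> X w i \<in> sets lebesgue"
      using lmeasurable_Lag[OF assms(1)] by blast
    show "f absolutely_integrable_on Lag \<Omega> X w i"
      by (rule absolutely_integrable_continuous_compact[OF compact_Lag[OF assms(1)]
            continuous_on_subset[OF assms(3) Lag_subset]])
  qed simp
  then show ?thesis by (simp only: UN_Lag)
qed

lemma vol_Lag_sum:
  assumes "compact \<Omega>" "X \<in> distinct_seeds"
  shows "vol \<Omega> = (\<Sum>i\<in>UNIV. vol (Lag \<Omega> X w i))"
proof -
  have "vol (\<Union>(Lag \<Omega> X w ` UNIV)) = (\<Sum>i\<in>UNIV. vol (Lag \<Omega> X w i))"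
    using negligible_Lag_Int[OF assms(2)] lmeasurable_Lag[OF assms(1)]
    by (intro measure_negligible_finite_Union_image) (auto simp: pairwise_def)
  then show ?thesis by (simp only: UN_Lag)
qed

lemma set_integral_lmeasurable_const:
  "A \<in> lmeasurable \<Longrightarrow> (LINT x:A|lebesgue. c) = vol A * (c :: real)"
  by (subst set_integral_const) (auto simp: fmeasurable_def)

text \<open>Splits off the part that depends on \<open>A\<close> only through its volume. When two
  tessellations with equal cell volumes are compared, that part cancels and only the first moments
  remain.\<close>

lemma set_integral_height:
  assumes "compact A"
  shows "(LINT x:A|lebesgue. height X w i x)
    = 2 * (LINT x:A|lebesgue. x \<bullet> X $ i) + vol A * (w $ i - (norm (X $ i))\<^sup>2)"
proof -
  have *: "set_integrable lebesgue A (\<lambda>x. 2 * (x \<bullet> X $ i))"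
    "set_integrable lebesgue A (\<lambda>x. w $ i - (norm (X $ i))\<^sup>2)"
    by (intro absolutely_integrable_continuous_compact assms continuous_intros)+
  have "(LINT x:A|lebesgue. height X w i x)
      = (LINT x:A|lebesgue. 2 * (x \<bullet> X $ i) + (w $ i - (norm (X $ i))\<^sup>2))"
    by (simp add: height_def algebra_simps)
  also have "\<dots> = 2 * (LINT x:A|lebesgue. x \<bullet> X $ i) + vol A * (w $ i - (norm (X $ i))\<^sup>2)"
    using assms by (subst set_integral_add(2)[OF *])
      (simp only: set_integral_mult_right set_integral_lmeasurable_const lmeasurable_compact)
  finally show ?thesis .
qed

section \<open>Comparison of tessellations and uniqueness of weights\<close>

text \<open>The shortfall of the \<open>i\<close>-th height below the envelope of \<open>X\<close>
  is nonnegative, and its integrals over the cells of \<open>Y\<close> add up to at most 0. Hence it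
  vanishes almost everywhere on each cell of \<open>Y\<close>. Continuity and convexity remove the
  exceptional null set.\<close>

lemma Lag_subset_of_sum_inner_le:
  fixes X Y :: "(real ^ 'd) ^ 'n"
  assumes \<Omega>: "compact \<Omega>" "convex \<Omega>"
    and X: "X \<in> distinct_seeds" and Y: "Y \<in> distinct_seeds"
    and vol_eq: "\<And>i. vol (Lag \<Omega> X w i) = vol (Lag \<Omega> Y u i)"
    and vol_pos: "\<And>i. 0 < vol (Lag \<Omega> Y u i)"
    and le: "(\<Sum>i\<in>UNIV. LINT x:Lag \<Omega> X w i|lebesgue. x \<bullet> X $ i)
        \<le> (\<Sum>i\<in>UNIV. LINT x:Lag \<Omega> Y u i|lebesgue. x \<bullet> X $ i)"
  shows "Lag \<Omega> Y u i \<subseteq> Lag \<Omega> X w i"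
proof -
  define gap where "gap i x = envelope X w x - height X w i x" for i x
  have gap_nonneg: "0 \<le> gap i x" for i x
    by (simp add: gap_def height_le_envelope)
  have cont_gap: "continuous_on S (gap i)" for S i
    unfolding gap_def by (intro continuous_intros continuous_on_envelope continuous_on_height)
  have int: "f absolutely_integrable_on Lag \<Omega> Z z i" if "continuous_on (Lag \<Omega> Z z i) f"
    for f :: "real ^ 'd \<Rightarrow> real" and Z :: "(real ^ 'd) ^ 'n" and z i
    using that by (intro absolutely_integrable_continuous_compact compact_Lag \<Omega>)
  have int_gap_nonneg: "0 \<le> (LINT x:Lag \<Omega> Y u i|lebesgue. gap i x)" for i
    unfolding set_lebesgue_integral_def by (intro integral_nonneg_AE) (simp add: gap_nonneg)
  have "(\<Sum>i\<in>UNIV. LINT x:Lag \<Omega> Y u i|lebesgue. gap i x)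
      = (\<Sum>i\<in>UNIV. LINT x:Lag \<Omega> Y u i|lebesgue. envelope X w x)
        - (\<Sum>i\<in>UNIV. LINT x:Lag \<Omega> Y u i|lebesgue. height X w i x)"
    unfolding gap_def sum_subtractf[symmetric]
    by (intro sum.cong refl set_integral_diff(2) int continuous_on_envelope continuous_on_height)
  \<comment> \<open>The integrand does not depend on \<open>i\<close>, so both sums are the integral
    over \<Omega> and the tessellation can be exchanged.\<close>
  also have "(\<Sum>i\<in>UNIV. LINT x:Lag \<Omega> Y u i|lebesgue. envelope X w x)
      = (\<Sum>i\<in>UNIV. LINT x:Lag \<Omega> X w i|lebesgue. envelope X w x)"
    using set_integral_Lag_sum[OF \<Omega>(1) X continuous_on_envelope]
      set_integral_Lag_sum[OF \<Omega>(1) Y continuous_on_envelope] by metis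
  also have "\<dots> = (\<Sum>i\<in>UNIV. LINT x:Lag \<Omega> X w i|lebesgue. height X w i x)"
    using lmeasurable_Lag[OF \<Omega>(1)]
    by (intro sum.cong refl set_lebesgue_integral_cong) (auto simp: mem_Lag_iff_envelope)
  also have "\<dots> - (\<Sum>i\<in>UNIV. LINT x:Lag \<Omega> Y u i|lebesgue. height X w i x) \<le> 0"
    using le by (simp add: set_integral_height compact_Lag \<Omega> vol_eq sum.distrib flip: sum_distrib_left)
  finally have "(\<Sum>i\<in>UNIV. LINT x:Lag \<Omega> Y u i|lebesgue. gap i x) \<le> 0" .
  with int_gap_nonneg have "(LINT x:Lag \<Omega> Y u i|lebesgue. gap i x) = 0"
    by (metis (mono_tags, lifting) UNIV_I finite order_antisym sum_nonneg sum_nonneg_eq_0_iff)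
  then have "AE x in lebesgue. indicat_real (Lag \<Omega> Y u i) x *\<^sub>R gap i x = 0"
    using int[OF cont_gap] unfolding set_lebesgue_integral_def set_integrable_def
    by (subst (asm) integral_nonneg_eq_0_iff_AE) (auto simp: gap_nonneg)
  \<comment> \<open>Restricting to the interior makes the set where the gap is nonzero open, and an
    open null set is empty.\<close>
  then have "AE x in lebesgue. x \<notin> interior (Lag \<Omega> Y u i) \<inter> {x. gap i x \<noteq> 0}"
    by eventually_elim (use interior_subset in \<open>auto simp: indicator_def\<close>)
  moreover have open_U: "open (interior (Lag \<Omega> Y u i) \<inter> {x. gap i x \<noteq> 0})"
    by (intro open_Int open_interior open_Collect_neq cont_gap continuous_on_const)
  ultimately have "negligible (interior (Lag \<Omega> Y u i) \<inter> {x. gap i x \<noteq> 0})"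
    by (simp add: negligible_iff_null_sets AE_iff_null_sets lmeasurable_open)
  then have "interior (Lag \<Omega> Y u i) \<inter> {x. gap i x \<noteq> 0} = {}"
    using open_not_negligible[OF open_U] by blast
  then have "interior (Lag \<Omega> Y u i) \<subseteq> Lag \<Omega> X w i"
    using interior_subset Lag_subset by (force simp: mem_Lag_iff_envelope gap_def)
  then have "closure (interior (Lag \<Omega> Y u i)) \<subseteq> Lag \<Omega> X w i"
    by (intro closure_minimal compact_imp_closed compact_Lag \<Omega>)
  \<comment> \<open>A convex set of positive volume has nonempty interior, so the closed cell is the
    closure of its interior and the inclusion extends to all of it.\<close>
  moreover have "\<not> negligible (Lag \<Omega> Y u i)"
    using vol_pos[of i] negligible_imp_measure0 by force
  then have "closure (interior (Lag \<Omega> Y u i)) = Lag \<Omega> Y u i"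
    using \<Omega> compact_Lag[OF \<Omega>(1), THEN compact_imp_closed, of Y u i]
    by (simp add: negligible_convex_interior convex_Lag convex_closure_interior)
  ultimately show ?thesis by simp
qed

text \<open>
  Where two cells meet, both weight vectors make the two heights agree, so the difference of the
  weights is the same for both indices; connectedness of \<open>\<Omega>\<close> propagates this to all indices.
\<close>

lemma weights_diff_const_of_Lag_subset:
  fixes X :: "(real ^ 'd) ^ 'n"
  assumes \<Omega>: "compact \<Omega>" "convex \<Omega>"
    and nonempty: "\<And>i. Lag \<Omega> X u i \<noteq> {}"
    and sub: "\<And>i. Lag \<Omega> X u i \<subseteq> Lag \<Omega> X w i"
  shows "w $ i - u $ i = w $ j - u $ j"
proof (rule ccontr)
  define S where "S = {k. w $ k - u $ k = w $ j - u $ j}"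
  assume "w $ i - u $ i \<noteq> w $ j - u $ j"
  then have "i \<notin> S" "j \<in> S" by (auto simp: S_def)
  have closed: "closed (\<Union>k\<in>T. Lag \<Omega> X u k)" for T
    by (intro closed_UN ballI compact_imp_closed compact_Lag \<Omega>) auto
  have cover: "(\<Union>k\<in>S. Lag \<Omega> X u k) \<union> (\<Union>k\<in>-S. Lag \<Omega> X u k) = \<Omega>"
    using UN_Lag[of \<Omega> X u] by blast
  have "(\<Union>k\<in>S. Lag \<Omega> X u k) \<inter> (\<Union>k\<in>-S. Lag \<Omega> X u k) \<inter> \<Omega> \<noteq> {}"
  proof
    assume "(\<Union>k\<in>S. Lag \<Omega> X u k) \<inter> (\<Union>k\<in>-S. Lag \<Omega> X u k) \<inter> \<Omega> = {}"
    from connected_closedD[OF convex_connected[OF \<Omega>(2)] this _ closed closed] cover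
    have "(\<Union>k\<in>S. Lag \<Omega> X u k) \<inter> \<Omega> = {} \<or> (\<Union>k\<in>-S. Lag \<Omega> X u k) \<inter> \<Omega> = {}" by blast
    with nonempty[of i] nonempty[of j] Lag_subset[of \<Omega> X u] \<open>i \<notin> S\<close> \<open>j \<in> S\<close> show False
      by blast
  qed
  then obtain x k l where "k \<in> S" "l \<notin> S" and x: "x \<in> Lag \<Omega> X u k" "x \<in> Lag \<Omega> X u l"
    by blast
  moreover have "w $ k - u $ k = w $ l - u $ l"
    using x sub[of k] sub[of l] by (force simp: mem_Lag_iff_envelope height_def)
  ultimately show False by (simp add: S_def)
qed

text \<open>The first-moment sums \<open>I w\<close> and \<open>I u\<close> are real numbers, so one
  is at most the other. The comparison of tessellations then gives inclusion of cells in one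
  direction, which suffices; the claim is symmetric in \<open>w\<close> and
  \<open>u\<close>.\<close>

lemma weights_diff_const:
  fixes X :: "(real ^ 'd) ^ 'n"
  assumes \<Omega>: "compact \<Omega>" "convex \<Omega>" and X: "X \<in> distinct_seeds"
    and vol_eq: "\<And>i. vol (Lag \<Omega> X w i) = vol (Lag \<Omega> X u i)"
    and vol_pos: "\<And>i. 0 < vol (Lag \<Omega> X u i)"
  shows "w $ i - u $ i = w $ j - u $ j"
proof -
  define I where "I w = (\<Sum>i\<in>UNIV. LINT x:Lag \<Omega> X w i|lebesgue. x \<bullet> X $ i)" for w
  have *: "w $ i - u $ i = w $ j - u $ j"
    if "I w \<le> I u" and "\<And>i. vol (Lag \<Omega> X w i) = vol (Lag \<Omega> X u i)"
      and "\<And>i. 0 < vol (Lag \<Omega> X u i)" for w u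
  proof (rule weights_diff_const_of_Lag_subset[OF \<Omega>])
    fix i
    show "Lag \<Omega> X u i \<noteq> {}" using that(3)[of i] by force
    show "Lag \<Omega> X u i \<subseteq> Lag \<Omega> X w i"
      using that Lag_subset_of_sum_inner_le[OF \<Omega> X X, of w u] by (simp add: I_def)
  qed
  consider "I w \<le> I u" | "I u \<le> I w" by linarith
  then show ?thesis
  proof cases
    case 1
    from *[OF this vol_eq vol_pos] show ?thesis .
  next
    case 2
    from *[OF this] vol_eq vol_pos show ?thesis by force
  qed
qed

section \<open>Existence of weights by minimisation\<close>

text \<open>The integral of \<open>(norm x)\<^sup>2\<close> over \<Omega> minus the Kantorovich dual
  functional of semi-discrete optimal transport with quadratic cost. For distinct seeds its partial
  derivative in \<open>w $ i\<close> is \<open>vol (Lag \<Omega> X w i) - v $ i\<close>, so critical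
  points are the weights sought.\<close>

definition kantorovich ::
  "(real ^ 'd) set \<Rightarrow> (real ^ 'd) ^ 'n \<Rightarrow> real ^ 'n \<Rightarrow> real ^ 'n \<Rightarrow> real" where
  "kantorovich \<Omega> X v w = (LINT x:\<Omega>|lebesgue. envelope X w x) - (\<Sum>i\<in>UNIV. v $ i * w $ i)"

lemma envelope_integrable: "compact \<Omega> \<Longrightarrow> envelope X w absolutely_integrable_on \<Omega>"
  by (intro absolutely_integrable_continuous_compact continuous_on_envelope)

lemma envelope_mono:
  assumes "\<And>i. w $ i \<le> u $ i + c"
  shows "envelope X w x \<le> envelope X u x + c"
proof -
  obtain i where "envelope X w x = height X w i x" by (rule envelope_attained)
  also have "\<dots> \<le> height X u i x + c" using assms by (simp add: height_def)
  also have "\<dots> \<le> envelope X u x + c" using height_le_envelope by simp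
  finally show ?thesis .
qed

text \<open>Serves twice: \<open>c = dist w u\<close> gives the Lipschitz bound behind continuity,
  and the pair \<open>c\<close>, \<open>- c\<close> gives the exact effect of shifting all
  weights.\<close>

lemma integral_envelope_mono:
  assumes "compact \<Omega>" "\<And>i. w $ i \<le> u $ i + c"
  shows "(LINT x:\<Omega>|lebesgue. envelope X w x) \<le> (LINT x:\<Omega>|lebesgue. envelope X u x) + vol \<Omega> * c"
proof -
  have c: "(\<lambda>x. c) absolutely_integrable_on \<Omega>"
    using assms(1) by (intro absolutely_integrable_continuous_compact continuous_intros)
  have "(LINT x:\<Omega>|lebesgue. envelope X w x) \<le> (LINT x:\<Omega>|lebesgue. envelope X u x + c)"
    using assms by (intro set_integral_mono set_integral_add(1) envelope_integrable c envelope_mono)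
  also have "\<dots> = (LINT x:\<Omega>|lebesgue. envelope X u x) + vol \<Omega> * c"
    using assms c by (simp add: set_integral_add(2) envelope_integrable
        set_integral_lmeasurable_const lmeasurable_compact)
  finally show ?thesis .
qed

lemma continuous_on_kantorovich:
  assumes "compact \<Omega>"
  shows "continuous_on S (kantorovich \<Omega> X v)"
proof -
  let ?I = "\<lambda>w. LINT x:\<Omega>|lebesgue. envelope X w x"
  have le: "?I w - ?I u \<le> vol \<Omega> * dist w u" for w u
  proof -
    have "w $ i \<le> u $ i + dist w u" for i
      using component_le_norm_cart[of "w - u" i] by (simp add: dist_norm)
    from integral_envelope_mono[OF assms this, of X] show ?thesis by simp
  qed
  have "(vol \<Omega>)-lipschitz_on S ?I"
  proof (rule lipschitz_onI)
    fix w u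
    show "dist (?I w) (?I u) \<le> vol \<Omega> * dist w u"
      using le[of w u] le[of u w] by (simp add: dist_real_def abs_le_iff dist_commute[of u w])
  qed simp
  then show ?thesis
    unfolding kantorovich_def by (intro continuous_intros lipschitz_on_continuous_on)
qed

lemma kantorovich_shift:
  assumes "compact \<Omega>" "(\<Sum>i\<in>UNIV. v $ i) = vol \<Omega>"
  shows "kantorovich \<Omega> X v (\<chi> i. w $ i + c) = kantorovich \<Omega> X v w"
proof -
  let ?w = "\<chi> i. w $ i + c"
  have "(LINT x:\<Omega>|lebesgue. envelope X ?w x) = (LINT x:\<Omega>|lebesgue. envelope X w x) + vol \<Omega> * c"
    using integral_envelope_mono[OF assms(1), of ?w w c X]
      integral_envelope_mono[OF assms(1), of w ?w "- c" X] by simp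
  moreover have "(\<Sum>i\<in>UNIV. v $ i * ?w $ i) = (\<Sum>i\<in>UNIV. v $ i * w $ i) + vol \<Omega> * c"
    by (simp add: distrib_left sum.distrib flip: assms(2) sum_distrib_right)
  ultimately show ?thesis by (simp add: kantorovich_def)
qed

text \<open>By shift invariance the largest weight may be taken to be 0. If some weight is then
  below \<open>- R\<close>, the value is at least that at 0, so a minimiser over the compact box
  \<open>[-R, 0]^n\<close> is a global one.\<close>

lemma kantorovich_attains_min:
  fixes X :: "(real ^ 'd) ^ 'n"
  assumes \<Omega>: "compact \<Omega>" and v: "v \<in> volume_vectors \<Omega>"
  obtains w where "\<And>u. kantorovich \<Omega> X v w \<le> kantorovich \<Omega> X v u"
proof -
  define F where "F = kantorovich \<Omega> X v"
  \<comment> \<open>\<open>- m x\<close> is the least of the heights at zero weights. It bounds the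
    envelope from below for every \<open>w\<close> that has some entry equal to 0, so
    \<open>D\<close> bounds the integral uniformly in such \<open>w\<close>.\<close>
  define m where "m x = (MAX i. - height X 0 i x)" for x
  define D where "D = (LINT x:\<Omega>|lebesgue. - m x)"
  define s where "s = Min (range (($) v))"
  have v_pos: "0 < v $ i" and v_sum: "(\<Sum>i\<in>UNIV. v $ i) = vol \<Omega>" for i
    using v by (auto simp: volume_vectors_def)
  have s: "0 < s" "s \<le> v $ i" for i
    using v_pos by (auto simp: s_def)
  \<comment> \<open>Chosen so that \<open>s * R\<close> is at least \<open>F 0 - D\<close>; the
    maximum with 0 keeps 0 inside the box.\<close>
  define R where "R = max 0 ((F 0 - D) / s)"
  have "continuous_on \<Omega> (\<lambda>x. - m x)"
    unfolding m_def by (intro continuous_intros continuous_on_Max_image continuous_on_height) auto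
  then have int_m: "(\<lambda>x. - m x) absolutely_integrable_on \<Omega>"
    by (intro absolutely_integrable_continuous_compact \<Omega>)
  have coercive: "F 0 \<le> F w" if "\<And>i. w $ i \<le> 0" "w $ k = 0" "w $ l < - R" for w k l
  proof -
    have "D \<le> (LINT x:\<Omega>|lebesgue. envelope X w x)"
      unfolding D_def
    proof (intro set_integral_mono int_m envelope_integrable \<Omega>)
      fix x
      have "- height X 0 k x \<le> m x" unfolding m_def by (intro Max_ge) auto
      then show "- m x \<le> envelope X w x"
        using height_le_envelope[of X w k x] that(2) by (simp add: height_def)
    qed
    moreover have "(\<Sum>i\<in>UNIV. v $ i * w $ i) \<le> v $ l * w $ l"
      using that(1) v_pos
      by (subst sum.remove[of _ l]) (auto intro!: sum_nonpos simp: mult_le_0_iff less_imp_le)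
    moreover have "v $ l * w $ l \<le> s * - R"
      using that(3) s(1) s(2)[of l] v_pos[of l] mult_mono[of s "v $ l" R "- w $ l"]
      by (simp add: R_def less_imp_le)
    moreover have "F 0 - D \<le> s * R"
      using s by (simp add: R_def field_simps max_def)
    ultimately show ?thesis by (simp add: F_def kantorovich_def)
  qed
  let ?C = "cbox (\<chi> i. - R) (0 :: real ^ 'n)"
  have "0 \<in> ?C" by (simp add: mem_box_cart R_def)
  then have "?C \<noteq> {}" by blast
  from continuous_attains_inf[OF compact_cbox this continuous_on_kantorovich[OF \<Omega>]]
  obtain w where w: "\<And>u. u \<in> ?C \<Longrightarrow> F w \<le> F u"
    unfolding F_def by blast
  have "F w \<le> F u" for u
  proof -
    \<comment> \<open>Subtracting the largest entry normalises \<open>u\<close>: all entries become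
      nonpositive and one becomes 0.\<close>
    define M where "M = Max (range (($) u))"
    define u' where "u' = (\<chi> i. u $ i + (- M))"
    have "M \<in> range (($) u)" unfolding M_def by (intro Max_in) auto
    then obtain k where k: "u' $ k = 0" by (auto simp: u'_def)
    have "u $ i \<le> M" for i unfolding M_def by (intro Max_ge) auto
    then have nonpos: "u' $ i \<le> 0" for i by (simp add: u'_def)
    have "F w \<le> F u'"
    proof (cases "\<exists>l. u' $ l < - R")
      case True
      then have "F 0 \<le> F u'" using coercive nonpos k by blast
      moreover have "F w \<le> F 0" by (intro w) fact
      ultimately show ?thesis by simp
    next
      case False
      then show ?thesis using nonpos by (intro w) (auto simp: mem_box_cart not_less)
    qed
    also have "F u' = F u"
      unfolding F_def u'_def by (rule kantorovich_shift[OF \<Omega> v_sum])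
    finally show ?thesis .
  qed
  then show thesis unfolding F_def by (rule that)
qed

text \<open>Outside the new \<open>i\<close>-th cell the envelope is attained by a height that was
  not raised; inside it grows by at most \<open>t\<close>. The bound involves the cell after the
  raise, so a limit of small \<open>t\<close> is needed to reach the cell of \<open>w\<close>
  itself.\<close>

lemma kantorovich_raise_weight:
  fixes X :: "(real ^ 'd) ^ 'n" and w :: "real ^ 'n" and i :: 'n
  assumes \<Omega>: "compact \<Omega>" and t: "0 \<le> t"
  defines "u \<equiv> \<chi> j. w $ j + (if j = i then t else 0)"
  shows "kantorovich \<Omega> X v u \<le> kantorovich \<Omega> X v w + t * (vol (Lag \<Omega> X u i) - v $ i)"
proof -
  have pw: "envelope X u x \<le> envelope X w x + t * indicat_real (Lag \<Omega> X u i) x" if "x \<in> \<Omega>" for x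
  proof (cases "x \<in> Lag \<Omega> X u i")
    case True
    then show ?thesis
      using envelope_mono[of u w t X x] t by (simp add: u_def)
  next
    case False
    obtain j where j: "envelope X u x = height X u j x" by (rule envelope_attained)
    with False that have "j \<noteq> i" by (auto simp: mem_Lag_iff_envelope)
    with j have "envelope X u x = height X w j x" by (simp add: u_def height_def)
    with False height_le_envelope[of X w j x] show ?thesis by simp
  qed
  have meas: "Lag \<Omega> X u i \<in> lmeasurable" by (rule lmeasurable_Lag[OF \<Omega>])
  have int: "(\<lambda>x. t * indicat_real (Lag \<Omega> X u i) x) absolutely_integrable_on \<Omega>"
  proof -
    have "(\<lambda>x. indicat_real \<Omega> x *\<^sub>R (t * indicat_real (Lag \<Omega> X u i) x))
        = (\<lambda>x. t * indicat_real (Lag \<Omega> X u i) x)"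
      using Lag_subset[of \<Omega> X u i] by (auto simp: fun_eq_iff indicator_def)
    with meas show ?thesis
      by (simp add: set_integrable_def lmeasurable_iff_integrable)
  qed
  have "(LINT x:\<Omega>|lebesgue. envelope X u x)
      \<le> (LINT x:\<Omega>|lebesgue. envelope X w x + t * indicat_real (Lag \<Omega> X u i) x)"
    by (intro set_integral_mono set_integral_add(1) envelope_integrable \<Omega> int pw)
  also have "\<dots> = (LINT x:\<Omega>|lebesgue. envelope X w x)
      + t * (LINT x:\<Omega>|lebesgue. indicat_real (Lag \<Omega> X u i) x)"
    by (simp add: set_integral_add(2) envelope_integrable \<Omega> int)
  also have "(LINT x:\<Omega>|lebesgue. indicat_real (Lag \<Omega> X u i) x) = vol (Lag \<Omega> X u i)"
    using Lag_subset[of \<Omega> X u i]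
    by (simp add: set_lebesgue_integral_def Int_absorb1 flip: indicator_inter_arith)
  moreover have "(\<Sum>j\<in>UNIV. v $ j * u $ j) = (\<Sum>j\<in>UNIV. v $ j * w $ j) + t * v $ i"
  proof -
    have "v $ j * u $ j = v $ j * w $ j + (if j = i then t * v $ i else 0)" for j
      by (simp add: u_def algebra_simps)
    then show ?thesis by (simp add: sum.distrib)
  qed
  ultimately show ?thesis by (simp add: kantorovich_def algebra_simps)
qed

lemma weights_exist:
  fixes X :: "(real ^ 'd) ^ 'n"
  assumes \<Omega>: "compact \<Omega>" and X: "X \<in> distinct_seeds" and v: "v \<in> volume_vectors \<Omega>"
  obtains w where "\<And>i. vol (Lag \<Omega> X w i) = v $ i"
proof -
  obtain w where w: "\<And>u. kantorovich \<Omega> X v w \<le> kantorovich \<Omega> X v u"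
    using kantorovich_attains_min[OF \<Omega> v] by blast
  \<comment> \<open>Only the one-sided variation that raises a single weight is needed: it gives \<open>\<ge>\<close> for each
    cell, and both sides have the same total.\<close>
  have ge: "v $ i \<le> vol (Lag \<Omega> X w i)" for i
  proof -
    \<comment> \<open>Raising the weight by \<open>1 / real (Suc n)\<close> gives decreasing cells
      \<open>A n\<close> whose intersection is the cell of \<open>w\<close>. Minimality of
      \<open>w\<close> bounds each \<open>vol (A n)\<close> below by \<open>v $ i\<close>, and the
      bound passes to the limit.\<close>
    define u where "u n = (\<chi> j. w $ j + (if j = i then 1 / real (Suc n) else 0))" for n
    define A where "A n = Lag \<Omega> X (u n) i" for n
    have mem_A: "x \<in> A n \<longleftrightarrow> x \<in> \<Omega> \<and> (\<forall>j. j \<noteq> i \<longrightarrow> height X w j x \<le> height X w i x + 1 / real (Suc n))"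
      for x n by (auto simp: A_def mem_Lag_iff height_def u_def algebra_simps)
    have "decseq A"
    proof (rule decseq_SucI, rule subsetI)
      fix n x assume "x \<in> A (Suc n)"
      moreover have "1 / real (Suc (Suc n)) \<le> 1 / real (Suc n)" by (intro divide_left_mono) auto
      ultimately show "x \<in> A n" unfolding mem_A by (meson add_left_mono order_trans)
    qed
    moreover have A: "A n \<in> lmeasurable" for n
      unfolding A_def by (rule lmeasurable_Lag[OF \<Omega>])
    ultimately have "(\<lambda>n. vol (A n)) \<longlonglongrightarrow> vol (\<Inter>n. A n)"
      using fmeasurableD[OF A] fmeasurableD2[OF A] by (intro Lim_measure_decseq) auto
    moreover have "(\<Inter>n. A n) = Lag \<Omega> X w i"
    proof (intro equalityI subsetI)
      fix x assume x: "x \<in> (\<Inter>n. A n)"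
      have "height X w j x \<le> height X w i x" if "j \<noteq> i" for j
      proof (rule LIMSEQ_le_const)
        show "(\<lambda>n. height X w i x + 1 / real (Suc n)) \<longlonglongrightarrow> height X w i x"
          using tendsto_add[OF tendsto_const LIMSEQ_Suc[OF lim_1_over_n]] by force
        show "\<exists>N. \<forall>n\<ge>N. height X w j x \<le> height X w i x + 1 / real (Suc n)"
          using x that by (auto simp: mem_A)
      qed
      with x show "x \<in> Lag \<Omega> X w i" by (force simp: mem_A mem_Lag_iff)
    next
      fix x assume "x \<in> Lag \<Omega> X w i"
      then show "x \<in> (\<Inter>n. A n)"
        by (auto simp: mem_A mem_Lag_iff intro: add_increasing2)
    qed
    moreover have "v $ i \<le> vol (A n)" for n
    proof -
      have "0 \<le> 1 / real (Suc n) * (vol (A n) - v $ i)"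
        using kantorovich_raise_weight[OF \<Omega>, of "1 / real (Suc n)" X v w i] w[of "u n"]
        by (simp add: A_def u_def)
      then show ?thesis by (simp add: zero_le_divide_iff)
    qed
    ultimately show ?thesis by (metis LIMSEQ_le_const)
  qed
  have "(\<Sum>i\<in>UNIV. vol (Lag \<Omega> X w i) - v $ i) = 0"
    using vol_Lag_sum[OF \<Omega> X, of w] v by (simp add: volume_vectors_def sum_subtractf)
  with ge have "vol (Lag \<Omega> X w i) = v $ i" for i
    by (subst (asm) sum_nonneg_eq_0_iff) auto
  with that show thesis by blast
qed

section \<open>Optimal cells and their determination by volumes and centroids\<close>

text \<open>Justifies the definite description in \<open>opt_weights\<close>: existing weights are
  shifted to vanish at \<open>Max UNIV\<close>, and two normalised solutions differ by a constant
  that is 0 at that index.\<close>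

lemma vol_opt_cell:
  fixes X :: "(real ^ 'd) ^ 'n::{finite,linorder}"
  assumes \<Omega>: "compact \<Omega>" "convex \<Omega>" and X: "X \<in> distinct_seeds" and v: "v \<in> volume_vectors \<Omega>"
  shows "vol (opt_cell \<Omega> X v i) = v $ i"
proof -
  let ?P = "\<lambda>w. w $ Max UNIV = 0 \<and> (\<forall>i. vol (Lag \<Omega> X w i) = v $ i)"
  have "\<exists>!w. ?P w"
  proof (rule ex_ex1I)
    obtain w where w: "\<And>i. vol (Lag \<Omega> X w i) = v $ i"
      using weights_exist[OF \<Omega>(1) X v] by blast
    have "?P (\<chi> i. w $ i + (- w $ Max UNIV))"
      unfolding Lag_shift by (simp add: w)
    then show "\<exists>w. ?P w" ..
  next
    fix w u assume w: "?P w" and u: "?P u"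
    have "w $ i - u $ i = w $ Max UNIV - u $ Max UNIV" for i
      using w u v by (intro weights_diff_const[OF \<Omega> X]) (auto simp: volume_vectors_def)
    with w u show "w = u" by (simp add: vec_eq_iff)
  qed
  from theI'[OF this] show ?thesis by (simp add: opt_cell_def opt_weights_def)
qed

lemma opt_cell_subset:
  fixes X Y :: "(real ^ 'd) ^ 'n::{finite,linorder}"
  assumes \<Omega>: "compact \<Omega>" "convex \<Omega>" and v: "v \<in> volume_vectors \<Omega>"
    and X: "X \<in> distinct_seeds" and Y: "Y \<in> distinct_seeds"
    and centroid_eq: "\<And>i. opt_centroid \<Omega> X v i = opt_centroid \<Omega> Y v i"
  shows "opt_cell \<Omega> Y v i \<subseteq> opt_cell \<Omega> X v i"
proof -
  have moment: "(LINT x:opt_cell \<Omega> Z v i|lebesgue. x \<bullet> c) = v $ i * (opt_centroid \<Omega> Z v i \<bullet> c)"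
    if Z: "Z \<in> distinct_seeds" for Z :: "(real ^ 'd) ^ 'n::{finite,linorder}" and i c
  proof -
    have "(\<lambda>x. x) absolutely_integrable_on opt_cell \<Omega> Z v i"
      unfolding opt_cell_def
      by (rule absolutely_integrable_continuous_compact[OF compact_Lag[OF \<Omega>(1)] continuous_on_id])
    moreover have "0 < v $ i" using v by (simp add: volume_vectors_def)
    ultimately show ?thesis
      by (simp add: set_integral_inner_right opt_centroid_def centroid_def vol_opt_cell[OF \<Omega> Z v])
  qed
  show ?thesis
    unfolding opt_cell_def
  proof (rule Lag_subset_of_sum_inner_le[OF \<Omega> X Y], fold opt_cell_def)
    fix i
    show "vol (opt_cell \<Omega> X v i) = vol (opt_cell \<Omega> Y v i)"
      using vol_opt_cell[OF \<Omega> _ v] X Y by simp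
    show "0 < vol (opt_cell \<Omega> Y v i)"
      using vol_opt_cell[OF \<Omega> Y v] v by (simp add: volume_vectors_def)
  qed (simp add: moment X Y centroid_eq)
qed

theorem theorem4p5:
  fixes \<Omega> :: "(real ^ 'd) set"
    and v :: "real ^ 'n::{finite,linorder}"
    and B X Y :: "(real ^ 'd) ^ 'n::{finite,linorder}"
  assumes "CARD('d) \<ge> 2"
    and "\<Omega> \<noteq> {}" and "convex \<Omega>" and "bounded \<Omega>" and "\<Omega> = closure (interior \<Omega>)"
    and "(v, B) \<in> compatible_data \<Omega>"
    and "X \<in> distinct_seeds" and "Y \<in> distinct_seeds"
    and "\<And>i. opt_centroid \<Omega> X v i = B $ i"
    and "\<And>i. opt_centroid \<Omega> Y v i = B $ i"
  shows "\<forall>i. opt_cell \<Omega> X v i = opt_cell \<Omega> Y v i"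
proof
  fix i
  have "compact \<Omega>"
    using assms(4,5) by (metis closed_closure compact_eq_bounded_closed)
  moreover have "v \<in> volume_vectors \<Omega>"
    using assms(6) by (simp add: compatible_data_def)
  \<comment> \<open>The centroid hypotheses are symmetric in \<open>X\<close> and \<open>Y\<close>,
    so the inclusion applies in both directions.\<close>
  ultimately show "opt_cell \<Omega> X v i = opt_cell \<Omega> Y v i"
    using assms(3,7-10) by (intro equalityI opt_cell_subset) simp_all
qed

end
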